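(* Let $0<q<1$. For all $n\in\mathbb{Z}_{+}=\{0,1,2,\dots\}$ and $x\in\mathbb{C}$, the following relations hold true: (i) $\varphi_{2n+1}(q^{-1/2}x;q^{-1})\,\mathcal{S}h_{q}(x)-q^{-n}\varphi_{2n}(x;q^{-1})\,\mathcal{C}h_{q}(q^{-1/2}x)=q^{-n^{2}}\mathcal{S}h_{q}(q^{n}x)$, (ii) $\varphi_{2n+1}(q^{-1/2}x;q^{-1})\,\mathcal{C}h_{q}(x)-q^{-n+1/2}\varphi_{2n}(x;q^{-1})\,\mathcal{S}h_{q}(q^{-1/2}x)=q^{-n^{2}}\mathcal{C}h_{q}(q^{n}x)$, (iii) $\varphi_{2n+1}(x;q^{-1})\,\mathcal{S}h_{q}(q^{-1/2}x)-q^{n}\varphi_{2n+2}(q^{-1/2}x;q^{-1})\,\mathcal{C}h_{q}(x)=q^{-n^{2}}\mathcal{S}h_{q}(q^{n+1/2}x)$, (iv) $\varphi_{2n+1}(x;q^{-1})\,\mathcal{C}h_{q}(q^{-1/2}x)-q^{n+1/2}\varphi_{2n+2}(q^{-1/2}x;q^{-1})\,\mathcal{S}h_{q}(x)=q^{-n^{2}}\mathcal{C}h_{q}(q^{n+1/2}x)$, (v) $\varphi_{n+1}(q^{-1/2}x;q^{-1})\,\mathcal{E}_{q}(x)-q^{-(2n-1)/4}\varphi_{n}(x;q^{-1})\,\mathcal{E}_{q}(q^{-1/2}x)=(-1)^{n}q^{-n^{2}/4}\mathcal{E}_{q}(q^{n/2}x)$.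
   Context: Here $0<q<1$ and fractional powers of $q$ are positive reals. $(a;q)_{n}=\prod_{k=0}^{n-1}(1-aq^{k})$. The $q^{-1}$-Fibonacci polynomials $\varphi_n(x;q^{-1})$, $n\in\mathbb{Z}_+$, are defined by $$\varphi_{n}(x;q^{-1})=\sum_{k\ge 0,\ 2k<n}\frac{(q;q)_{n-k-1}}{(q;q)_{k}(q;q)_{n-2k-1}}\,q^{k(k+1-n)}x^{n-2k-1};$$ equivalently $\varphi_0=0$, $\varphi_1=1$ and $\varphi_{n+1}(x;q^{-1})=x\varphi_{n}(x;q^{-1})+q^{-(n-1)}\varphi_{n-1}(x;q^{-1})$ for $n\ge1$. The $q$-exponential, $q$-sine and $q$-cosine are the entire functions $$\mathcal{E}_{q}(z)=\sum_{n=0}^{\infty}\frac{q^{n^{2}/4}}{(q;q)_{n}}z^{n},\qquad \mathcal{S}_{q}(z)=\sum_{n=0}^{\infty}\frac{(-1)^{n}q^{n(n+1)}}{(q;q)_{2n+1}}z^{2n+1},\qquad \mathcal{C}_{q}(z)=\sum_{n=0}^{\infty}\frac{(-1)^{n}q^{n^{2}}}{(q;q)_{2n}}z^{2n},$$ and $\mathcal{S}h_{q}(z)=-\mathrm{i}\,\mathcal{S}_{q}(\mathrm{i}z)$, $\mathcal{C}h_{q}(z)=\mathcal{C}_{q}(\mathrm{i}z)$. *)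

theory Defs
  imports "HOL-Analysis.Analysis"
begin

definition qpochhammer :: "'a::comm_ring_1 \<Rightarrow> 'a \<Rightarrow> nat \<Rightarrow> 'a" where
  "qpochhammer a q n = (\<Prod>k<n. 1 - a * q ^ k)"

(* qinv_fib q n x stands for phi_n(x; q^(-1)): the first argument is q itself, not its inverse.
   The exponent k * (k + 1 - n) of q is a non-positive integer; the natural-number
   subtractions do not truncate, because 2 * k < n. *)
definition qinv_fib :: "real \<Rightarrow> nat \<Rightarrow> complex \<Rightarrow> complex" where
  "qinv_fib q n x =
     (\<Sum>k | 2 * k < n.
        of_real (qpochhammer q q (n - k - 1) / (qpochhammer q q k * qpochhammer q q (n - 2 * k - 1))
                 * q powi (int k * (int k + 1 - int n))) * x ^ (n - 2 * k - 1))"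

definition qexp :: "real \<Rightarrow> complex \<Rightarrow> complex" where
  "qexp q z = (\<Sum>n. of_real (q powr ((real n)\<^sup>2 / 4) / qpochhammer q q n) * z ^ n)"

definition qsin :: "real \<Rightarrow> complex \<Rightarrow> complex" where
  "qsin q z =
     (\<Sum>n. of_real ((-1) ^ n * q ^ (n * (n + 1)) / qpochhammer q q (2 * n + 1)) * z ^ (2 * n + 1))"

definition qcos :: "real \<Rightarrow> complex \<Rightarrow> complex" where
  "qcos q z = (\<Sum>n. of_real ((-1) ^ n * q ^ (n\<^sup>2) / qpochhammer q q (2 * n)) * z ^ (2 * n))"

definition qsinh :: "real \<Rightarrow> complex \<Rightarrow> complex" where
  "qsinh q z = - \<i> * qsin q (\<i> * z)"

definition qcosh :: "real \<Rightarrow> complex \<Rightarrow> complex" where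
  "qcosh q z = qcos q (\<i> * z)"

end

theory Submission
  imports Defs
begin

text \<open>
  Everything rests on one fact about the \<open>q\<close>-exponential: cancelling the factor
  \<open>1 - q\<^sup>n\<close> against \<open>(q;q)\<^sub>n\<close> in its power series gives
  \<open>E(z) - E(q z) = q\<^sup>1\<^sup>/\<^sup>4 z E(q\<^sup>1\<^sup>/\<^sup>2 z)\<close>
  (\<open>qexp_functional_equation\<close>). Read along the geometric progression
  \<open>q\<^sup>n\<^sup>/\<^sup>2 x\<close>, this is a second-order linear recurrence in \<open>n\<close>. After the
  normalisation by \<open>(-1)\<^sup>n q\<close> to the power \<open>-n\<^sup>2/4\<close> it becomes the recurrence
  of the polynomials \<open>\<phi>\<close> (\<open>qinv_fib_recurrence\<close>), evaluated at
  \<open>q\<close> to the power \<open>-1/2\<close> times \<open>x\<close>.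
  Relation (v) says that a solution of this recurrence is the combination of two
  other solutions determined by its values at \<open>n = 0\<close> and \<open>n = 1\<close>, so it follows
  by two-step induction (\<open>qexp_qinv_fib\<close>).

  The \<open>q\<close>-hyperbolic cosine is the even part of the \<open>q\<close>-exponential, and
  \<open>q\<^sup>1\<^sup>/\<^sup>4\<close> times the \<open>q\<close>-hyperbolic sine is its odd part, while
  \<open>\<phi>\<^sub>n\<close> is odd or even according to whether \<open>n\<close> is even or odd.
  Relations (i) and (ii) are therefore the odd and the even part in \<open>x\<close>
  of (v) with index \<open>2 n\<close>, and (iii) and (iv) those of (v) with index \<open>2 n + 1\<close>,
  rescaled.
\<close>

section \<open>The polynomials\<close>

lemma qpochhammer_0 [simp]: "qpochhammer a q 0 = 1"
  by (simp add: qpochhammer_def)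

lemma qpochhammer_Suc [simp]: "qpochhammer a q (Suc n) = qpochhammer a q n * (1 - a * q ^ n)"
  by (simp add: qpochhammer_def)

lemma qpochhammer_q_q_nonzero:
  fixes q :: real
  assumes "0 < q" "q < 1"
  shows "qpochhammer q q n \<noteq> 0"
proof -
  have "q * q ^ k < 1" for k
    using assms power_Suc_less_one[of q k] by simp
  then show ?thesis
    by (auto simp: qpochhammer_def dest: less_imp_neq)
qed

definition qinv_fib_coeff :: "real \<Rightarrow> nat \<Rightarrow> nat \<Rightarrow> real" where
  "qinv_fib_coeff q n k =
     qpochhammer q q (n - k - 1) / (qpochhammer q q k * qpochhammer q q (n - 2 * k - 1))
       * q powi (int k * (int k + 1 - int n))"

lemma qinv_fib_eq_sum_coeff:
  "qinv_fib q n x = (\<Sum>k | 2 * k < n. of_real (qinv_fib_coeff q n k) * x ^ (n - 2 * k - 1))"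
  by (simp add: qinv_fib_def qinv_fib_coeff_def)

lemma qinv_fib_coeff_0:
  assumes "0 < q" "q < 1"
  shows "qinv_fib_coeff q (Suc n) 0 = 1"
  using qpochhammer_q_q_nonzero[OF assms] by (simp add: qinv_fib_coeff_def)

text \<open>
  The \<open>q\<close>-Pascal rule in disguise. With the common factors removed it reads
  \<open>1 - q\<^sup>a\<^sup>+\<^sup>b = (1 - q\<^sup>a) q\<^sup>b + (1 - q\<^sup>b)\<close> for
  \<open>a = n - 2 k - 1\<close> and \<open>b = k + 1\<close>. The extreme coefficient with
  \<open>a = 0\<close> has no first term on the right.
\<close>
lemma qinv_fib_coeff_Suc:
  assumes "0 < q" "q < 1" "2 * k < n"
  shows "qinv_fib_coeff q (Suc (Suc n)) (Suc k) =
           (if 2 * Suc k < Suc n then qinv_fib_coeff q (Suc n) (Suc k) else 0)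
             + q powi (- int n) * qinv_fib_coeff q n k"
proof -
  note nz = qpochhammer_q_q_nonzero[OF assms(1,2)]
  have q0: "q \<noteq> 0" using assms by simp
  have one_minus: "1 - q * q ^ m \<noteq> 0" for m
    using nz[of "Suc m"] by simp
  define m where "m = n - 2 * k - 1"
  have n: "n = 2 * k + 1 + m" using assms(3) by (simp add: m_def)
  define u where "u = q powi (int k * (int k + 1 - int n)) * q powi (- int n)"
  have e1: "q powi (int (Suc k) * (int (Suc k) + 1 - int (Suc (Suc n)))) = u"
    unfolding u_def by (subst power_int_add[symmetric], simp add: q0) (simp add: algebra_simps)
  have e2: "q powi (int (Suc k) * (int (Suc k) + 1 - int (Suc n))) = u * (q * q ^ k)"
  proof -
    have "q * q ^ k = q powi (1 + int k)"
      using q0 by (simp add: power_int_add)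
    moreover have "int (Suc k) * (int (Suc k) + 1 - int (Suc n))
        = int k * (int k + 1 - int n) + - int n + (1 + int k)"
      by (simp add: algebra_simps)
    ultimately show ?thesis
      unfolding u_def using q0 by (simp only: power_int_add simp_thms)
  qed
  have L: "qinv_fib_coeff q (Suc (Suc n)) (Suc k) =
    qpochhammer q q (k + m) * (1 - q * q ^ (k + m))
      / (qpochhammer q q k * (1 - q * q ^ k) * qpochhammer q q m) * u"
    unfolding qinv_fib_coeff_def e1 using n by (simp add: algebra_simps)
  have R2: "q powi (- int n) * qinv_fib_coeff q n k =
    qpochhammer q q (k + m) / (qpochhammer q q k * qpochhammer q q m) * u"
    unfolding qinv_fib_coeff_def u_def using n by simp
  show ?thesis
  proof (cases m)
    case 0
    then show ?thesis
      unfolding L R2 using n nz one_minus[of k] q0 by (simp add: field_simps)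
  next
    case (Suc l)
    have R1: "qinv_fib_coeff q (Suc n) (Suc k) =
      qpochhammer q q (k + m) / (qpochhammer q q k * (1 - q * q ^ k) * qpochhammer q q l) * (u * (q * q ^ k))"
      unfolding qinv_fib_coeff_def e2 using n Suc by (simp add: algebra_simps)
    have "2 * Suc k < Suc n" using n Suc by simp
    then show ?thesis
      unfolding L R2 R1 using Suc nz[of k] nz[of l] one_minus[of k] one_minus[of l] q0
      by (simp add: divide_simps power_add) (simp add: algebra_simps)
  qed
qed

lemma qinv_fib_0 [simp]: "qinv_fib q 0 x = 0"
  by (simp add: qinv_fib_def)

lemma qinv_fib_1 [simp]: "qinv_fib q (Suc 0) x = 1"
proof -
  have "{k :: nat. 2 * k < Suc 0} = {0}" by auto
  then show ?thesis by (simp add: qinv_fib_def)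
qed

lemma qinv_fib_recurrence:
  assumes "0 < q" "q < 1"
  shows "qinv_fib q (Suc (Suc n)) x =
           x * qinv_fib q (Suc n) x + of_real (q powr (- real n)) * qinv_fib q n x"
proof -
  let ?c = "\<lambda>n k. complex_of_real (qinv_fib_coeff q n k)"
  let ?I = "{k :: nat. 2 * k < n}"
  have fin: "finite {k :: nat. 2 * k < m}" for m
    by (rule finite_subset[of _ "{..<m}"]) auto
  have split: "{k :: nat. 2 * k < Suc (Suc n)} = insert 0 (Suc ` ?I)"
  proof safe
    fix k assume "2 * k < Suc (Suc n)" "k \<notin> Suc ` ?I"
    then show "k = 0" by (cases k) auto
  qed auto
  \<comment> \<open>Peeling off the leading term aligns the power \<open>x ^ (n - 2 * k - 1)\<close> on both sides.\<close>
  have peel: "qinv_fib q (Suc (Suc n)) x =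
      x ^ Suc n + (\<Sum>k\<in>?I. ?c (Suc (Suc n)) (Suc k) * x ^ (n - 2 * k - 1))"
    using fin unfolding qinv_fib_eq_sum_coeff split
    by (subst sum.insert) (auto simp: qinv_fib_coeff_0[OF assms] sum.reindex)
  have middle: "x * qinv_fib q (Suc n) x =
      x ^ Suc n + (\<Sum>k\<in>?I. (if 2 * Suc k < Suc n then ?c (Suc n) (Suc k) else 0) * x ^ (n - 2 * k - 1))"
  proof -
    have "x * qinv_fib q (Suc n) x =
        (\<Sum>k | 2 * k < Suc n. ?c (Suc n) k * x ^ (Suc n - 2 * k))"
      unfolding qinv_fib_eq_sum_coeff sum_distrib_left
      by (rule sum.cong) (auto simp: power_Suc[symmetric] Suc_diff_le simp del: power_Suc)
    also have "\<dots> = (\<Sum>k | 2 * k < Suc (Suc n).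
        (if 2 * k < Suc n then ?c (Suc n) k else 0) * x ^ (Suc n - 2 * k))"
      by (rule sum.mono_neutral_cong_left) (use fin in auto)
    also have "\<dots> = x ^ Suc n +
        (\<Sum>k\<in>?I. (if 2 * Suc k < Suc n then ?c (Suc n) (Suc k) else 0) * x ^ (n - 2 * k - 1))"
      using fin unfolding split
      by (subst sum.insert) (auto simp: qinv_fib_coeff_0[OF assms] sum.reindex intro!: sum.cong)
    finally show ?thesis .
  qed
  have "q powr (- real n) = q powi (- int n)"
    using assms powr_real_of_int'[of q "- int n"] by simp
  then show ?thesis
    unfolding peel middle unfolding qinv_fib_eq_sum_coeff[of q n]
    by (auto simp: qinv_fib_coeff_Suc[OF assms] sum_distrib_left add.assoc sum.distrib[symmetric]
        distrib_right mult.assoc simp flip: of_real_power_int intro!: sum.cong)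
qed

lemma qinv_fib_minus:
  assumes "0 < q" "q < 1"
  shows "qinv_fib q n (- x) = (-1) ^ Suc n * qinv_fib q n x"
  by (induct n rule: induct_nat_012) (simp_all add: qinv_fib_recurrence[OF assms] algebra_simps)

section \<open>The q-exponential\<close>

definition qexp_term :: "real \<Rightarrow> complex \<Rightarrow> nat \<Rightarrow> complex" where
  "qexp_term q z n = of_real (q powr ((real n)\<^sup>2 / 4) / qpochhammer q q n) * z ^ n"

text \<open>The quotient of consecutive terms tends to zero, because \<open>q\<close> to the power \<open>(2 n + 1)/4\<close> does.\<close>
lemma summable_qexp_term:
  assumes "0 < q" "q < 1"
  shows "summable (qexp_term q z)"
proof -
  have ratio: "norm (qexp_term q z (Suc n)) =
      q powr ((2 * real n + 1) / 4) / (1 - q * q ^ n) * norm z * norm (qexp_term q z n)" for n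
  proof -
    have "q * q ^ n < 1" using assms power_Suc_less_one[of q n] by simp
    moreover have "q powr ((real (Suc n))\<^sup>2 / 4) = q powr ((real n)\<^sup>2 / 4) * q powr ((2 * real n + 1) / 4)"
      by (subst powr_add[symmetric]) (simp add: power2_eq_square field_simps)
    moreover have "cmod (1 - of_real q * of_real q ^ n) = \<bar>1 - q * q ^ n\<bar>"
      by (metis norm_of_real of_real_1 of_real_diff of_real_mult of_real_power)
    ultimately show ?thesis
      by (simp add: qexp_term_def norm_mult norm_divide norm_power mult_ac del: of_nat_Suc)
  qed
  have "(\<lambda>n. q powr ((2 * real n + 1) / 4)) \<longlonglongrightarrow> 0"
  proof -
    have "q powr ((2 * real n + 1) / 4) = q powr (1/4) * (q powr (1/2)) ^ n" for n
      using assms by (simp add: powr_powr powr_add[symmetric] flip: powr_realpow) (simp add: field_simps)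
    moreover have "q powr (1/2) < 1" using assms by (simp add: powr_half_sqrt)
    ultimately show ?thesis
      using LIMSEQ_power_zero[of "q powr (1/2)"] by (auto intro!: tendsto_eq_intros)
  qed
  moreover have "(\<lambda>n. 1 - q * q ^ n) \<longlonglongrightarrow> 1"
    using assms LIMSEQ_power_zero[of q] by (auto intro!: tendsto_eq_intros)
  ultimately have "(\<lambda>n. q powr ((2 * real n + 1) / 4) / (1 - q * q ^ n)) \<longlonglongrightarrow> 0 / 1"
    by (rule tendsto_divide) simp
  then have "(\<lambda>n. q powr ((2 * real n + 1) / 4) / (1 - q * q ^ n) * norm z) \<longlonglongrightarrow> 0"
    using tendsto_mult_left_zero by fastforce
  then have "eventually (\<lambda>n. q powr ((2 * real n + 1) / 4) / (1 - q * q ^ n) * norm z < 1/2) sequentially"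
    by (rule order_tendstoD) simp
  then obtain N where N: "\<And>n. n \<ge> N \<Longrightarrow> q powr ((2 * real n + 1) / 4) / (1 - q * q ^ n) * norm z < 1/2"
    by (auto simp: eventually_sequentially)
  show ?thesis
  proof (rule summable_ratio_test[of "1/2" N])
    show "norm (qexp_term q z (Suc n)) \<le> 1/2 * norm (qexp_term q z n)" if "n \<ge> N" for n
      unfolding ratio by (intro mult_right_mono less_imp_le[OF N[OF that]]) simp
  qed simp
qed

lemma qexp_term_sums:
  assumes "0 < q" "q < 1"
  shows "qexp_term q z sums qexp q z"
  using summable_sums[OF summable_qexp_term[OF assms, of z]]
  by (simp add: qexp_def qexp_term_def[abs_def])

text \<open>
  In \<open>E(z) - E(q z)\<close> the \<open>n\<close>-th term gains the factor \<open>1 - q\<^sup>n\<close>,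
  which lowers the index of \<open>(q;q)\<^sub>n\<close>; since
  \<open>(n + 1)\<^sup>2/4 = n\<^sup>2/4 + n/2 + 1/4\<close>, what remains is a
  \<open>q\<close>-exponential series at \<open>q\<^sup>1\<^sup>/\<^sup>2 z\<close>.
\<close>
lemma qexp_functional_equation:
  assumes "0 < q" "q < 1"
  shows "qexp q z - qexp q (of_real q * z) =
           of_real (q powr (1/4)) * z * qexp q (of_real (q powr (1/2)) * z)"
proof -
  let ?r = "of_real (q powr (1/2)) :: complex"
  let ?d = "\<lambda>n. qexp_term q z n - qexp_term q (of_real q * z) n"
  have step: "?d (Suc n) = of_real (q powr (1/4)) * z * qexp_term q (?r * z) n" for n
  proof -
    have nz: "qpochhammer q q n \<noteq> 0" "1 - q * q ^ n \<noteq> 0"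
      using qpochhammer_q_q_nonzero[OF assms, of n] qpochhammer_q_q_nonzero[OF assms, of "Suc n"] by auto
    have "q powr ((real (Suc n))\<^sup>2 / 4) =
        q powr (1/4) * (q powr ((real n)\<^sup>2 / 4) * (q powr (1/2)) ^ n)"
    proof -
      have "(q powr (1/2)) ^ n = q powr (real n / 2)"
        using assms by (simp add: powr_powr flip: powr_realpow)
      then show ?thesis
        by (simp only: powr_add[symmetric]) (simp add: power2_eq_square field_simps)
    qed
    then have "q powr ((real (Suc n))\<^sup>2 / 4) / qpochhammer q q (Suc n) * (1 - q ^ Suc n) =
        q powr (1/4) * (q powr ((real n)\<^sup>2 / 4) / qpochhammer q q n * (q powr (1/2)) ^ n)"
      using nz by (simp del: of_nat_Suc)
    moreover have "?d (Suc n) = of_real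
        (q powr ((real (Suc n))\<^sup>2 / 4) / qpochhammer q q (Suc n) * (1 - q ^ Suc n)) * z ^ Suc n"
      unfolding qexp_term_def power_mult_distrib of_real_mult of_real_diff of_real_1 of_real_power
      by (simp only: algebra_simps mult_1)
    ultimately show ?thesis
      by (simp only:) (simp add: qexp_term_def power_mult_distrib)
  qed
  have "(\<lambda>n. ?d (Suc n)) sums (of_real (q powr (1/4)) * z * qexp q (?r * z))"
    unfolding step by (intro sums_mult qexp_term_sums assms)
  moreover have "?d 0 = 0"
    by (simp add: qexp_term_def)
  ultimately have "?d sums (of_real (q powr (1/4)) * z * qexp q (?r * z))"
    using sums_Suc[of ?d] by simp
  moreover have "?d sums (qexp q z - qexp q (of_real q * z))"
    by (intro sums_diff qexp_term_sums assms)
  ultimately show ?thesis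
    by (rule sums_unique2[symmetric])
qed

lemma qexp_recurrence:
  assumes "0 < q" "q < 1"
  shows "qexp q (of_real (q powr (t + 1)) * x) =
           qexp q (of_real (q powr t) * x)
             - of_real (q powr (1/4 + t)) * x * qexp q (of_real (q powr (t + 1/2)) * x)"
  using qexp_functional_equation[OF assms, of "of_real (q powr t) * x"] assms
  by (simp add: powr_add algebra_simps)

section \<open>Even and odd parts of the q-exponential\<close>

lemma qcosh_eq_even_part:
  assumes "0 < q" "q < 1"
  shows "qcosh q z = (qexp q z + qexp q (- z)) / 2"
proof -
  let ?f = "\<lambda>n. (qexp_term q z n + qexp_term q (- z) n) / 2"
  have "?f sums ((qexp q z + qexp q (- z)) / 2)"
    by (intro sums_divide sums_add qexp_term_sums assms)
  moreover have "?f n = 0" if "n \<notin> range (\<lambda>n. 2 * n)" for n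
  proof -
    have "odd n" using that by (metis evenE rangeI)
    then show ?thesis by (simp add: qexp_term_def)
  qed
  ultimately have "(\<lambda>n. ?f (2 * n)) sums ((qexp q z + qexp q (- z)) / 2)"
    by (subst sums_mono_reindex) (auto simp: strict_mono_def)
  moreover have "?f (2 * n) =
      of_real ((-1) ^ n * q ^ (n\<^sup>2) / qpochhammer q q (2 * n)) * (\<i> * z) ^ (2 * n)" for n
  proof -
    have "q powr ((real (2 * n))\<^sup>2 / 4) = q ^ (n\<^sup>2)"
      using assms by (simp add: power_mult_distrib flip: powr_realpow)
    moreover have "(\<i> * z) ^ (2 * n) = (-1) ^ n * z ^ (2 * n)"
      by (simp add: power_mult_distrib power_mult power_minus[of "z\<^sup>2"])
    ultimately show ?thesis
      by (simp add: qexp_term_def flip: power_add)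
  qed
  ultimately show ?thesis
    by (simp add: qcosh_def qcos_def sums_iff)
qed

text \<open>The factor comes from \<open>(2 n + 1)\<^sup>2/4 = n (n + 1) + 1/4\<close>.\<close>
lemma qsinh_eq_odd_part:
  assumes "0 < q" "q < 1"
  shows "of_real (q powr (1/4)) * qsinh q z = (qexp q z - qexp q (- z)) / 2"
proof -
  let ?f = "\<lambda>n. (qexp_term q z n - qexp_term q (- z) n) / 2"
  let ?s = "of_real (q powr (1/4)) :: complex"
  let ?g = "\<lambda>n. of_real ((-1) ^ n * q ^ (n * (n + 1)) / qpochhammer q q (2 * n + 1))
                  * (\<i> * z) ^ (2 * n + 1) :: complex"
  have "?f sums ((qexp q z - qexp q (- z)) / 2)"
    by (intro sums_divide sums_diff qexp_term_sums assms)
  moreover have "?f n = 0" if "n \<notin> range (\<lambda>n. 2 * n + 1)" for n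
  proof -
    have "even n" using that by (metis oddE rangeI)
    then show ?thesis by (simp add: qexp_term_def)
  qed
  ultimately have "(\<lambda>n. ?f (2 * n + 1)) sums ((qexp q z - qexp q (- z)) / 2)"
    by (subst sums_mono_reindex) (auto simp: strict_mono_def)
  moreover have "?f (2 * n + 1) = - \<i> * ?s * ?g n" for n
  proof -
    have "(real (2 * n + 1))\<^sup>2 / 4 = 1/4 + real (n * (n + 1))"
      by (simp add: power2_eq_square field_simps)
    then have "q powr ((real (2 * n + 1))\<^sup>2 / 4) = q powr (1/4) * q ^ (n * (n + 1))"
      using assms by (simp only: powr_add powr_realpow)
    then have f: "?f (2 * n + 1) =
        ?s * of_real ((-1) ^ n * q ^ (n * (n + 1)) / qpochhammer q q (2 * n + 1)) * ((-1) ^ n * z ^ (2 * n + 1))"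
      by (simp add: qexp_term_def minus_one_power_iff)
    have i: "(-1) ^ n * z ^ (2 * n + 1) = - \<i> * (\<i> * z) ^ (2 * n + 1)"
      by (simp add: power_mult_distrib power_mult power_minus[of "z\<^sup>2"])
        (simp add: mult.assoc mult.left_commute)
    show ?thesis
      unfolding f i by (simp only: mult_ac)
  qed
  ultimately have "(\<lambda>n. - \<i> * ?s * ?g n) sums ((qexp q z - qexp q (- z)) / 2)"
    by simp
  then have "?g sums ((qexp q z - qexp q (- z)) / 2 / (- \<i> * ?s))"
    by (rule sums_mult_D) (use assms in simp)
  then have "qsin q (\<i> * z) = (qexp q z - qexp q (- z)) / 2 / (- \<i> * ?s)"
    by (simp add: qsin_def sums_iff)
  then show ?thesis
    using assms by (simp add: qsinh_def)
qed

section \<open>The connection formulas\<close>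

text \<open>
  All three products satisfy the recurrence
  \<open>y\<^sub>n\<^sub>+\<^sub>2 = w x y\<^sub>n\<^sub>+\<^sub>1 + c y\<^sub>n\<close> with \<open>w\<close> and \<open>c\<close> equal to
  \<open>q\<close> to the powers \<open>-1/2\<close> and \<open>-(n + 1)\<close>; the prefactors on both sides are
  what turns the recurrences of \<open>\<phi>\<^sub>n(x)\<close> and of
  \<open>E(q\<^sup>n\<^sup>/\<^sup>2 x)\<close> into this common form.
\<close>
lemma qexp_qinv_fib:
  assumes "0 < q" "q < 1"
  shows "qinv_fib q (Suc n) (of_real (q powr (-1/2)) * x) * qexp q x
       - of_real (q powr (- (2 * real n - 1) / 4)) * qinv_fib q n x * qexp q (of_real (q powr (-1/2)) * x)
     = (-1) ^ n * of_real (q powr (- (real n)\<^sup>2 / 4)) * qexp q (of_real (q powr (real n / 2)) * x)"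
proof (induct n rule: induct_nat_012)
  case 0
  show ?case using assms by simp
next
  case 1
  define r where "r = complex_of_real (q powr - (1/4))"
  have w: "complex_of_real (q powr (-1/2)) = r * r"
    unfolding r_def of_real_mult[symmetric] powr_add[symmetric] by simp
  have "qexp q (r * r * x) = r * x * qexp q x + qexp q (of_real (q powr (1/2)) * x)"
    using qexp_recurrence[OF assms, of "-1/2" x] assms by (simp add: w[symmetric]) (simp add: r_def)
  moreover have "qinv_fib q (Suc (Suc 0)) (r * r * x) = r * r * x"
    by (simp add: qinv_fib_recurrence[OF assms])
  ultimately show ?case
    unfolding w by (simp add: r_def[symmetric] algebra_simps)
next
  case (ge2 n)
  let ?w = "complex_of_real (q powr (-1/2))"
  let ?c = "complex_of_real (q powr (- real (Suc n)))"
  let ?a = "\<lambda>n. complex_of_real (q powr (- (2 * real n - 1) / 4))"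
  let ?b = "\<lambda>n. complex_of_real (q powr (- (real n)\<^sup>2 / 4))"
  let ?e = "\<lambda>n. qexp q (of_real (q powr (real n / 2)) * x)"
  have a1: "?a (Suc (Suc n)) = ?w * ?a (Suc n)"
    unfolding of_real_mult[symmetric] powr_add[symmetric]
    by (intro arg_cong[where f = complex_of_real] arg_cong[where f = "(powr) q"]) (simp add: field_simps)
  have a2: "?a (Suc (Suc n)) * of_real (q powr (- real n)) = ?c * ?a n"
    unfolding of_real_mult[symmetric] powr_add[symmetric] by (simp add: field_simps)
  have b1: "?b (Suc (Suc n)) = ?c * ?b n"
    unfolding of_real_mult[symmetric] powr_add[symmetric]
    by (intro arg_cong[where f = complex_of_real] arg_cong[where f = "(powr) q"])
      (simp add: field_simps power2_eq_square)
  have b2: "?b (Suc (Suc n)) * of_real (q powr (1/4 + real n / 2)) = ?w * ?b (Suc n)"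
    unfolding of_real_mult[symmetric] powr_add[symmetric]
    by (intro arg_cong[where f = complex_of_real] arg_cong[where f = "(powr) q"])
      (simp add: field_simps power2_eq_square)
  have "?e (Suc (Suc n)) = ?e n - of_real (q powr (1/4 + real n / 2)) * x * ?e (Suc n)"
    using qexp_recurrence[OF assms, of "real n / 2" x] by (simp add: add_divide_distrib algebra_simps)
  then have b_e: "?b (Suc (Suc n)) * ?e (Suc (Suc n)) = ?c * ?b n * ?e n - ?w * ?b (Suc n) * x * ?e (Suc n)"
    by (simp only: right_diff_distrib mult.assoc[symmetric] b2) (simp only: b1)
  have right: "?a (Suc (Suc n)) * qinv_fib q (Suc (Suc n)) x =
      ?w * x * (?a (Suc n) * qinv_fib q (Suc n) x) + ?c * (?a n * qinv_fib q n x)"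
    unfolding qinv_fib_recurrence[OF assms, of n x] distrib_left mult.assoc[symmetric] a2
    unfolding a1 by (simp only: ac_simps)
  have left: "qinv_fib q (Suc (Suc (Suc n))) (?w * x) =
      ?w * x * qinv_fib q (Suc (Suc n)) (?w * x) + ?c * qinv_fib q (Suc n) (?w * x)"
    by (rule qinv_fib_recurrence[OF assms])
  let ?E = "qexp q x" and ?F = "qexp q (?w * x)"
  have "qinv_fib q (Suc (Suc (Suc n))) (?w * x) * ?E - ?a (Suc (Suc n)) * qinv_fib q (Suc (Suc n)) x * ?F
    = ?w * x * (qinv_fib q (Suc (Suc n)) (?w * x) * ?E - ?a (Suc n) * qinv_fib q (Suc n) x * ?F)
      + ?c * (qinv_fib q (Suc n) (?w * x) * ?E - ?a n * qinv_fib q n x * ?F)"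
    unfolding left right by (simp only: algebra_simps)
  also have "\<dots> = ?w * x * ((-1) ^ Suc n * ?b (Suc n) * ?e (Suc n)) + ?c * ((-1) ^ n * ?b n * ?e n)"
    unfolding ge2 ..
  also have "\<dots> = (-1) ^ n * (?c * ?b n * ?e n - ?w * ?b (Suc n) * x * ?e (Suc n))"
    by (simp add: algebra_simps)
  also have "\<dots> = (-1) ^ Suc (Suc n) * ?b (Suc (Suc n)) * ?e (Suc (Suc n))"
    unfolding b_e[symmetric] by simp
  finally show ?case .
qed

theorem proposition8:
  fixes q :: real and n :: nat and x :: complex
  assumes "0 < q" and "q < 1"
  shows
    "qinv_fib q (2 * n + 1) (of_real (q powr (-1/2)) * x) * qsinh q x
       - of_real (q powr (- real n)) * qinv_fib q (2 * n) x * qcosh q (of_real (q powr (-1/2)) * x)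
     = of_real (q powr (- (real n)\<^sup>2)) * qsinh q (of_real (q powr real n) * x) \<and>
     qinv_fib q (2 * n + 1) (of_real (q powr (-1/2)) * x) * qcosh q x
       - of_real (q powr (- real n + 1/2)) * qinv_fib q (2 * n) x * qsinh q (of_real (q powr (-1/2)) * x)
     = of_real (q powr (- (real n)\<^sup>2)) * qcosh q (of_real (q powr real n) * x) \<and>
     qinv_fib q (2 * n + 1) x * qsinh q (of_real (q powr (-1/2)) * x)
       - of_real (q powr real n) * qinv_fib q (2 * n + 2) (of_real (q powr (-1/2)) * x) * qcosh q x
     = of_real (q powr (- (real n)\<^sup>2)) * qsinh q (of_real (q powr (real n + 1/2)) * x) \<and>
     qinv_fib q (2 * n + 1) x * qcosh q (of_real (q powr (-1/2)) * x)
       - of_real (q powr (real n + 1/2)) * qinv_fib q (2 * n + 2) (of_real (q powr (-1/2)) * x) * qsinh q x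
     = of_real (q powr (- (real n)\<^sup>2)) * qcosh q (of_real (q powr (real n + 1/2)) * x) \<and>
     qinv_fib q (n + 1) (of_real (q powr (-1/2)) * x) * qexp q x
       - of_real (q powr (- (2 * real n - 1) / 4)) * qinv_fib q n x * qexp q (of_real (q powr (-1/2)) * x)
     = (-1) ^ n * of_real (q powr (- (real n)\<^sup>2 / 4)) * qexp q (of_real (q powr (real n / 2)) * x)"
proof -
  note par = qinv_fib_minus[OF assms]
  define w where "w = complex_of_real (q powr (-1/2))"
  define s where "s = complex_of_real (q powr (1/4))"
  have s0: "s \<noteq> 0" using assms by (simp add: s_def)
  have E: "qexp q z = qcosh q z + s * qsinh q z" "qexp q (- z) = qcosh q z - s * qsinh q z" for z
    unfolding s_def qcosh_eq_even_part[OF assms] qsinh_eq_odd_part[OF assms]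
    by (simp_all add: field_simps)

  \<comment> \<open>Index \<open>2 n\<close>: replacing \<open>x\<close> by \<open>- x\<close> fixes the polynomial \<open>A\<close> and negates \<open>B\<close>,
    so half the sum and half the difference of the two relations are the even and the odd part.\<close>
  define A where "A = qinv_fib q (2 * n + 1) (w * x)"
  define B where "B = qinv_fib q (2 * n) x"
  define c where "c = complex_of_real (q powr (- real n))"
  define d where "d = complex_of_real (q powr (- (real n)\<^sup>2))"
  define y where "y = complex_of_real (q powr real n) * x"
  have c_s: "complex_of_real (q powr (- (2 * real (2 * n) - 1) / 4)) = c * s"
    unfolding c_def s_def of_real_mult[symmetric] powr_add[symmetric] by (simp add: field_simps)
  have c_s2: "complex_of_real (q powr (- real n + 1/2)) = c * s * s"
    unfolding c_def s_def of_real_mult[symmetric] powr_add[symmetric] by simp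
  have even_plus: "A * qexp q x - c * s * B * qexp q (w * x) = d * qexp q y"
    using qexp_qinv_fib[OF assms, of "2 * n" x, folded w_def] unfolding c_s
    by (simp add: A_def B_def d_def y_def power_mult_distrib)
  have even_minus: "A * qexp q (- x) + c * s * B * qexp q (- (w * x)) = d * qexp q (- y)"
    using qexp_qinv_fib[OF assms, of "2 * n" "- x", folded w_def] unfolding c_s
    by (simp add: A_def B_def d_def y_def power_mult_distrib par)

  \<comment> \<open>Index \<open>2 n + 1\<close>, multiplied by \<open>q\<close> to the power \<open>n + 1/4\<close> and with reversed sign;
    this removes the power of \<open>q\<close> in front of \<open>A'\<close>. Under \<open>x \<mapsto> - x\<close> again only \<open>B'\<close> changes sign.\<close>
  define A' where "A' = qinv_fib q (2 * n + 1) x"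
  define B' where "B' = qinv_fib q (2 * n + 2) (w * x)"
  define c' where "c' = complex_of_real (q powr real n)"
  define y' where "y' = complex_of_real (q powr (real n + 1/2)) * x"
  have c'_s: "c' * s * of_real (q powr (- (2 * real (2 * n + 1) - 1) / 4)) = 1"
    unfolding c'_def s_def of_real_mult[symmetric] powr_add[symmetric]
    using assms by (simp add: field_simps)
  have c'_d: "c' * s * of_real (q powr (- (real (2 * n + 1))\<^sup>2 / 4)) = d"
    unfolding c'_def s_def d_def of_real_mult[symmetric] powr_add[symmetric]
    by (simp add: field_simps power2_eq_square)
  have c'_s2: "complex_of_real (q powr (real n + 1/2)) = c' * s * s"
    unfolding c'_def s_def of_real_mult[symmetric] powr_add[symmetric] by (simp add: add.commute)
  have half: "real (2 * n + 1) / 2 = real n + 1/2"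
    by (simp add: field_simps)
  have odd_plus: "A' * qexp q (w * x) - c' * s * B' * qexp q x = d * qexp q y'"
  proof -
    have "B' * qexp q x - of_real (q powr (- (2 * real (2 * n + 1) - 1) / 4)) * A' * qexp q (w * x)
        = - of_real (q powr (- (real (2 * n + 1))\<^sup>2 / 4)) * qexp q y'"
      using qexp_qinv_fib[OF assms, of "2 * n + 1" x, folded w_def] unfolding half
      by (simp add: A'_def B'_def y'_def)
    then show ?thesis using c'_s c'_d by algebra
  qed
  have odd_minus: "A' * qexp q (- (w * x)) + c' * s * B' * qexp q (- x) = d * qexp q (- y')"
  proof -
    have "- B' * qexp q (- x) - of_real (q powr (- (2 * real (2 * n + 1) - 1) / 4)) * A' * qexp q (- (w * x))
        = - of_real (q powr (- (real (2 * n + 1))\<^sup>2 / 4)) * qexp q (- y')"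
      using qexp_qinv_fib[OF assms, of "2 * n + 1" "- x", folded w_def] unfolding half
      by (simp add: A'_def B'_def y'_def par)
    then show ?thesis using c'_s c'_d by algebra
  qed

  have sinh_even: "A * qsinh q x - c * B * qcosh q (w * x) = d * qsinh q y"
  proof -
    have "2 * s * (A * qsinh q x - c * B * qcosh q (w * x)) = 2 * s * (d * qsinh q y)"
      using even_plus even_minus unfolding E(2) unfolding E(1) by algebra
    then show ?thesis using s0 by (simp only: mult_cancel_left) simp
  qed
  have cosh_even: "A * qcosh q x - c * s * s * B * qsinh q (w * x) = d * qcosh q y"
  proof -
    have "2 * (A * qcosh q x - c * s * s * B * qsinh q (w * x)) = 2 * (d * qcosh q y)"
      using even_plus even_minus unfolding E(2) unfolding E(1) by algebra
    then show ?thesis using s0 by (simp only: mult_cancel_left) simp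
  qed
  have sinh_odd: "A' * qsinh q (w * x) - c' * B' * qcosh q x = d * qsinh q y'"
  proof -
    have "2 * s * (A' * qsinh q (w * x) - c' * B' * qcosh q x) = 2 * s * (d * qsinh q y')"
      using odd_plus odd_minus unfolding E(2) unfolding E(1) by algebra
    then show ?thesis using s0 by (simp only: mult_cancel_left) simp
  qed
  have cosh_odd: "A' * qcosh q (w * x) - c' * s * s * B' * qsinh q x = d * qcosh q y'"
  proof -
    have "2 * (A' * qcosh q (w * x) - c' * s * s * B' * qsinh q x) = 2 * (d * qcosh q y')"
      using odd_plus odd_minus unfolding E(2) unfolding E(1) by algebra
    then show ?thesis using s0 by (simp only: mult_cancel_left) simp
  qed
  show ?thesis
    using sinh_even cosh_even sinh_odd cosh_odd qexp_qinv_fib[OF assms, of n x]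
    unfolding c_s2[symmetric] c'_s2[symmetric]
    unfolding A_def A'_def B_def B'_def c_def c'_def d_def w_def y_def y'_def
    by (simp only: Suc_eq_plus1 simp_thms)
qed

end
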